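(* Let $1\leq p<\infty$, $0<\alpha\leq 1$ and $f\in H^p$. Then the following are equivalent: (b) $M_p(r,f')=O\left((1-r)^{\alpha-1}\right)$ as $r\to 1^{-}$; (c) $\|f_r-f\|_p=O\left((1-r)^{\alpha}\right)$ as $r\to 1^{-}$.
   Context: $\mathbb{D}$ is the open unit disc in $\mathbb{C}$. For $g$ analytic on $\mathbb{D}$, $1\leq p<\infty$ and $0\leq r<1$, $M_p(r,g)=\left(\frac{1}{2\pi}\int_{-\pi}^{\pi}|g(re^{i\theta})|^p\,d\theta\right)^{1/p}$. The Hardy space $H^p$ consists of all analytic $g:\mathbb{D}\to\mathbb{C}$ with $\|g\|_p=\sup_{0\leq r<1}M_p(r,g)<\infty$. The dilations of an analytic function $f$ on $\mathbb{D}$ are $f_r(z)=f(rz)$, $0\leq r<1$. *)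

theory Defs
  imports "HOL-Complex_Analysis.Complex_Analysis" "HOL-Library.Landau_Symbols"
begin

definition integral_mean :: "real \<Rightarrow> real \<Rightarrow> (complex \<Rightarrow> complex) \<Rightarrow> real" where
  "integral_mean p r g =
     (1 / (2 * pi) * integral {-pi..pi} (\<lambda>\<theta>. norm (g (of_real r * exp (\<i> * of_real \<theta>))) powr p))
       powr (1 / p)"

text \<open>
  The supremum is taken in the reals, so \<open>hardy_norm p g\<close> is meaningful only if the integral
  means of \<open>g\<close> are bounded. This boundedness is what \<open>hardy_space\<close> requires in place of
  a finite supremum, and lemma \<open>dilation_diff_in_hardy_space\<close> provides it for \<open>f\<^sub>r - f\<close>.
\<close>

definition hardy_norm :: "real \<Rightarrow> (complex \<Rightarrow> complex) \<Rightarrow> real" where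
  "hardy_norm p g = (SUP r\<in>{0..<1}. integral_mean p r g)"

definition hardy_space :: "real \<Rightarrow> (complex \<Rightarrow> complex) set" where
  "hardy_space p =
     {g. g holomorphic_on ball 0 1 \<and> bdd_above ((\<lambda>r. integral_mean p r g) ` {0..<1})}"

definition dilation :: "real \<Rightarrow> (complex \<Rightarrow> complex) \<Rightarrow> complex \<Rightarrow> complex" where
  "dilation r f = (\<lambda>z. f (of_real r * z))"

lemma integrand_integrable:
  assumes "g holomorphic_on ball 0 1" "0 \<le> r" "r < 1" "1 \<le> p"
  shows "(\<lambda>\<theta>. norm (g (of_real r * exp (\<i> * of_real \<theta>))) powr p) integrable_on {-pi..pi}"
proof -
  have "continuous_on (ball 0 1) g"
    using assms(1) by (rule holomorphic_on_imp_continuous_on)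
  then have "continuous_on {-pi..pi} (\<lambda>\<theta>. g (of_real r * exp (\<i> * of_real \<theta>)))"
    by (rule continuous_on_compose2) (use assms in \<open>auto intro!: continuous_intros simp: norm_mult\<close>)
  then have "continuous_on {-pi..pi} (\<lambda>\<theta>. norm (g (of_real r * exp (\<i> * of_real \<theta>))) powr p)"
    using assms(4) by (intro continuous_on_powr' continuous_intros) auto
  then show ?thesis by (rule integrable_continuous_interval)
qed

lemma integral_mean_powr:
  assumes "1 \<le> p"
  shows "integral_mean p r g powr p =
    1 / (2 * pi) * integral {-pi..pi} (\<lambda>\<theta>. norm (g (of_real r * exp (\<i> * of_real \<theta>))) powr p)"
proof -
  have "0 \<le> integral {-pi..pi} (\<lambda>\<theta>. norm (g (of_real r * exp (\<i> * of_real \<theta>))) powr p)"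
    by (cases "(\<lambda>\<theta>. norm (g (of_real r * exp (\<i> * of_real \<theta>))) powr p) integrable_on {-pi..pi}")
       (auto intro: integral_nonneg simp: not_integrable_integral)
  then show ?thesis using assms by (simp add: integral_mean_def powr_powr)
qed

lemma norm_diff_powr_le:
  fixes a b :: complex
  assumes "1 \<le> p"
  shows "norm (a - b) powr p \<le> 2 powr p * (norm a powr p + norm b powr p)"
proof -
  have "norm (a - b) \<le> 2 * max (norm a) (norm b)"
    using norm_triangle_ineq4[of a b] by linarith
  then have "norm (a - b) powr p \<le> (2 * max (norm a) (norm b)) powr p"
    using assms by (intro powr_mono2) auto
  also have "\<dots> = 2 powr p * max (norm a) (norm b) powr p"
    by (simp add: powr_mult)
  also have "max (norm a) (norm b) powr p \<le> norm a powr p + norm b powr p"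
    by (simp add: max_def)
  finally show ?thesis by simp
qed

lemma dilation_diff_in_hardy_space:
  assumes p: "1 \<le> p" and f: "f \<in> hardy_space p" and r: "0 \<le> r" "r < 1"
  shows "(\<lambda>z. dilation r f z - f z) \<in> hardy_space p"
proof -
  let ?h = "\<lambda>z. dilation r f z - f z"
  have hf: "f holomorphic_on ball 0 1" using f by (simp add: hardy_space_def)
  have "norm (of_real r * z) < 1" if "norm z < 1" for z :: complex
    using mult_left_le[of "norm z" r] r that by (simp add: norm_mult mult_le_less_imp_less)
  then have "(f \<circ> (\<lambda>z. of_real r * z)) holomorphic_on ball 0 1"
    by (intro holomorphic_on_compose_gen[OF _ hf] holomorphic_intros) auto
  then have hd: "dilation r f holomorphic_on ball 0 1" by (simp add: dilation_def o_def)
  have hh: "?h holomorphic_on ball 0 1" using hd hf by (intro holomorphic_intros)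
  obtain B where B: "\<And>s. 0 \<le> s \<Longrightarrow> s < 1 \<Longrightarrow> integral_mean p s f \<le> B"
    using f by (fastforce simp: hardy_space_def bdd_above_def)
  have "integral_mean p s ?h \<le> (2 powr p * (B powr p + B powr p)) powr (1 / p)"
    if s: "0 \<le> s" "s < 1" for s
  proof -
    let ?e = "\<lambda>\<theta>. exp (\<i> * of_real \<theta>) :: complex"
    have rs: "0 \<le> r * s" "r * s < 1"
      using r s by (auto simp: mult_le_one) (metis mult_left_le_one_le order_le_less_trans less_eq_real_def)
    have Bp: "integral_mean p t f powr p \<le> B powr p" if "0 \<le> t" "t < 1" for t
      using B[OF that] p by (intro powr_mono2) (auto simp: integral_mean_def)
    have md: "integral_mean p s (dilation r f) = integral_mean p (r * s) f"
      by (simp add: integral_mean_def dilation_def mult.assoc)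
    have "integral {-pi..pi} (\<lambda>\<theta>. norm (?h (of_real s * ?e \<theta>)) powr p)
        \<le> integral {-pi..pi} (\<lambda>\<theta>. 2 powr p *
            (norm (dilation r f (of_real s * ?e \<theta>)) powr p + norm (f (of_real s * ?e \<theta>)) powr p))"
      by (intro integral_le integrable_on_mult_right integrable_add
                integrand_integrable[OF hh] integrand_integrable[OF hd] integrand_integrable[OF hf]
                norm_diff_powr_le s p)
    also have "\<dots> = 2 powr p *
        (integral {-pi..pi} (\<lambda>\<theta>. norm (dilation r f (of_real s * ?e \<theta>)) powr p)
          + integral {-pi..pi} (\<lambda>\<theta>. norm (f (of_real s * ?e \<theta>)) powr p))"
      using integrand_integrable[OF hd s p] integrand_integrable[OF hf s p]
      by (simp add: Henstock_Kurzweil_Integration.integral_add)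
    finally have "1 / (2 * pi) * integral {-pi..pi} (\<lambda>\<theta>. norm (?h (of_real s * ?e \<theta>)) powr p)
        \<le> 1 / (2 * pi) * \<dots>"
      by (intro mult_left_mono) auto
    then have "integral_mean p s ?h powr p
        \<le> 2 powr p * (integral_mean p s (dilation r f) powr p + integral_mean p s f powr p)"
      unfolding integral_mean_powr[OF p] by (simp add: field_simps)
    also have "\<dots> \<le> 2 powr p * (B powr p + B powr p)"
      unfolding md using Bp[OF rs] Bp[OF s] by (intro mult_left_mono add_mono) auto
    finally have "(integral_mean p s ?h powr p) powr (1 / p)
        \<le> (2 powr p * (B powr p + B powr p)) powr (1 / p)"
      using p by (intro powr_mono2) auto
    moreover have "0 \<le> integral_mean p s ?h" by (simp add: integral_mean_def)
    ultimately show ?thesis using p by (simp add: powr_powr)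
  qed
  then have "bdd_above ((\<lambda>s. integral_mean p s ?h) ` {0..<1})"
    by (intro bdd_aboveI2) auto
  with hh show ?thesis by (simp add: hardy_space_def)
qed

end

theory Submission
  imports Defs
begin

text \<open>
  The Hardy--Littlewood principle that the growth of the derivative measures the rate of
  approximation by dilations. Write \<open>a \<rho>\<close> for the \<open>p\<close>-mean of \<open>f'\<close> on the circle of radius \<open>\<rho>\<close>.

  If \<open>a\<close> is \<open>O((1 - \<rho>) powr (\<alpha> - 1))\<close>, then \<open>f - f\<^sub>r\<close> on the circle of radius \<open>\<rho>\<close> is the integral of \<open>f'\<close>
  along the radial segments from radius \<open>r \<rho>\<close> to radius \<open>\<rho>\<close>. By Minkowski's integral inequality
  (\<open>Minkowski_integral_weighted\<close>) its mean is at most the integral of a constant multiple of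
  \<open>(1 - t) powr (\<alpha> - 1)\<close> over a segment of length at most \<open>1 - r\<close>, hence \<open>O((1 - r) powr \<alpha>)\<close>
  uniformly in \<open>\<rho>\<close> (\<open>integral_mean_dilation_diff_le\<close>).

  For the converse, let \<open>h = f\<^sub>r - f\<close>, so that \<open>f' z = r f' (r z) - h' z\<close>. Cauchy's formula,
  again with Minkowski's inequality, bounds the mean of \<open>h'\<close> by a multiple of the Hardy norm of \<open>h\<close>
  divided by the distance to the unit circle (\<open>integral_mean_deriv_le_Cauchy\<close>). Choosing \<open>r\<close> such that
  \<open>r \<rho> = 2 \<rho> - 1\<close>, which doubles the distance to the unit circle, gives
  \<open>a \<rho> \<le> a (2 \<rho> - 1) + D (1 - \<rho>) powr (\<alpha> - 1)\<close>. For \<open>\<alpha> < 1\<close> the doubling multiplies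
  \<open>(1 - \<rho>) powr (\<alpha> - 1)\<close> by a factor smaller than \<open>1\<close>, and the recursion sums like a geometric
  series (\<open>doubling_recursion_bound\<close>). For \<open>\<alpha> = 1\<close> it would only yield a logarithm. There, the
  difference quotients \<open>(f\<^sub>r - f) / (r - 1)\<close> have bounded means and converge to \<open>z f' z\<close>, which bounds \<open>a\<close>
  directly (\<open>integral_mean_deriv_le_difference_quotient\<close>).
\<close>

section \<open>Minkowski's integral inequality with a weight\<close>

text \<open>
  Convexity of \<open>x \<mapsto> x powr p\<close> in the form in which it is integrated below: the graph lies above its
  tangent at \<open>m\<close>, an inequality that is Young's inequality for \<open>x\<close> and \<open>m powr (p - 1)\<close>. It is
  applied to \<open>x / D\<close> and multiplied by \<open>D\<close>, so that it can be summed over pieces of weight \<open>D\<close>.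
\<close>

lemma powr_tangent_le:
  fixes p m x D :: real
  assumes p: "1 \<le> p" and m: "0 < m" and x: "0 \<le> x" and D: "0 < D"
  shows "p * m powr (p - 1) * x \<le> x powr p * D powr (1 - p) + (p - 1) * m powr p * D"
proof -
  have tangent: "p * m powr (p - 1) * y \<le> y powr p + (p - 1) * m powr p" if y: "0 \<le> y" for y
  proof (cases "p = 1")
    case False
    then have p1: "1 < p" using p by simp
    have "y * m powr (p - 1) \<le> y powr p / p + (m powr (p - 1)) powr (p / (p - 1)) / (p / (p - 1))"
      using p1 y m by (intro Youngs_inequality) (auto simp: field_simps)
    also have "(m powr (p - 1)) powr (p / (p - 1)) = m powr p"
      using p1 by (simp add: powr_powr)
    finally show ?thesis using p1 by (simp add: field_simps)
  qed (use m y in simp)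
  have "p * m powr (p - 1) * (x / D) * D \<le> ((x / D) powr p + (p - 1) * m powr p) * D"
    using D x by (intro mult_right_mono tangent) auto
  moreover have "(x / D) powr p * D = x powr p * D powr (1 - p)"
    using D x by (simp add: powr_divide powr_diff)
  ultimately show ?thesis using D by (simp add: algebra_simps)
qed

text \<open>
  This is Jensen's inequality for the probability measure \<open>\<phi> dt / \<integral>\<phi>\<close>: the integrand is written as
  \<open>(f / \<phi>) \<cdot> \<phi>\<close>, and the tangent inequality is integrated at the mean value of \<open>norm f / \<phi>\<close>.
\<close>

lemma norm_integral_powr_le_weighted:
  fixes f :: "real \<Rightarrow> complex" and \<phi> :: "real \<Rightarrow> real"
  assumes p: "1 \<le> p" and ab: "a < b"
    and f: "continuous_on {a..b} f" and \<phi>: "continuous_on {a..b} \<phi>"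
    and pos: "\<And>t. t \<in> {a..b} \<Longrightarrow> 0 < \<phi> t"
  shows "norm (integral {a..b} f) powr p
    \<le> integral {a..b} \<phi> powr (p - 1) * integral {a..b} (\<lambda>t. norm (f t) powr p * \<phi> t powr (1 - p))"
proof -
  have pos': "0 \<le> \<phi> t" "\<phi> t \<noteq> 0" if "t \<in> {a..b}" for t using pos[OF that] by auto
  define \<Phi> where "\<Phi> = integral {a..b} \<phi>"
  define A where "A = integral {a..b} (\<lambda>t. norm (f t))"
  define J where "J = integral {a..b} (\<lambda>t. norm (f t) powr p * \<phi> t powr (1 - p))"
  have i\<phi>: "\<phi> integrable_on {a..b}" using \<phi> by (rule integrable_continuous_interval)
  have ifn: "(\<lambda>t. norm (f t)) integrable_on {a..b}"
    by (intro integrable_continuous_interval continuous_intros f)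
  have cJ: "continuous_on {a..b} (\<lambda>t. norm (f t) powr p * \<phi> t powr (1 - p))"
    using p pos by (intro continuous_on_mult continuous_on_powr continuous_on_powr' continuous_intros f \<phi>) (auto simp: pos')
  have iJ: "(\<lambda>t. norm (f t) powr p * \<phi> t powr (1 - p)) integrable_on {a..b}"
    using cJ by (rule integrable_continuous_interval)
  have \<Phi>0: "0 \<le> \<Phi>" unfolding \<Phi>_def by (intro integral_nonneg i\<phi> pos'(1))
  have "\<Phi> \<noteq> 0"
    using integral_eq_0_iff[OF \<phi> ab pos'(1)] pos'(2)[of a] ab unfolding \<Phi>_def by auto
  with \<Phi>0 have \<Phi>: "0 < \<Phi>" by simp
  have J0: "0 \<le> J" unfolding J_def by (intro integral_nonneg iJ) auto
  have nA: "norm (integral {a..b} f) \<le> A"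
    unfolding A_def by (intro integral_norm_bound_integral integrable_continuous_interval f ifn) (auto simp: f ifn)
  have "A powr p \<le> \<Phi> powr (p - 1) * J"
  proof (cases "A = 0")
    case True
    then show ?thesis using J0 p by simp
  next
    case False
    have "0 \<le> A" unfolding A_def by (intro integral_nonneg ifn) auto
    with False have A: "0 < A" by simp
    \<comment> \<open>The mean of \<open>norm f / \<phi>\<close> with respect to the normalised weight.\<close>
    define m where "m = A / \<Phi>"
    have m: "0 < m" using A \<Phi> by (simp add: m_def)
    have pw: "p * m powr (p - 1) * norm (f t) \<le>
        norm (f t) powr p * \<phi> t powr (1 - p) + (p - 1) * m powr p * \<phi> t"
      if t: "t \<in> {a..b}" for t
      using pos[OF t] by (intro powr_tangent_le p m) auto
    have "p * m powr (p - 1) * A \<le> J + (p - 1) * m powr p * \<Phi>"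
    proof -
      have "integral {a..b} (\<lambda>t. p * m powr (p - 1) * norm (f t)) \<le>
        integral {a..b} (\<lambda>t. norm (f t) powr p * \<phi> t powr (1 - p) + (p - 1) * m powr p * \<phi> t)"
        by (intro integral_le integrable_on_mult_right integrable_add iJ i\<phi> ifn pw)
      then show ?thesis
        using iJ i\<phi> by (simp add: A_def J_def \<Phi>_def Henstock_Kurzweil_Integration.integral_add
            integrable_on_mult_right)
    qed
    moreover have e: "p * m powr (p - 1) * A = p * m powr p * \<Phi>"
      using A \<Phi> by (simp add: powr_diff m_def)
    ultimately have "m powr p * \<Phi> \<le> J" unfolding e by (simp add: algebra_simps)
    then have "\<Phi> powr (p - 1) * (m powr p * \<Phi>) \<le> \<Phi> powr (p - 1) * J"
      by (intro mult_left_mono) auto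
    moreover have "\<Phi> powr (p - 1) * (m powr p * \<Phi>) = A powr p"
      using \<Phi> A by (simp add: m_def powr_divide powr_diff)
    ultimately show ?thesis by simp
  qed
  moreover have "norm (integral {a..b} f) powr p \<le> A powr p"
    using nA p by (intro powr_mono2) auto
  ultimately show ?thesis unfolding \<Phi>_def J_def by simp
qed

text \<open>
  A family that is bounded in \<open>L\<^sup>p\<close> by \<open>\<phi> t\<close> has its integral over \<open>t\<close> bounded by \<open>\<integral>\<phi>\<close>.
  With the bound \<open>\<phi>\<close> itself as the weight of the previous lemma, the powers of \<open>\<phi>\<close> cancel after
  Fubini's theorem: \<open>\<phi> powr (1 - p) * \<phi> powr p = \<phi>\<close>.
\<close>

lemma Minkowski_integral_weighted:
  fixes F :: "real \<Rightarrow> real \<Rightarrow> complex" and \<phi> :: "real \<Rightarrow> real"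
  assumes p: "1 \<le> p" and ab: "a \<le> b"
    and F: "continuous_on ({a..b} \<times> {c..d}) (\<lambda>(t, \<theta>). F t \<theta>)"
    and \<phi>: "continuous_on {a..b} \<phi>" and pos: "\<And>t. t \<in> {a..b} \<Longrightarrow> 0 < \<phi> t"
    and le: "\<And>t. t \<in> {a..b} \<Longrightarrow> integral {c..d} (\<lambda>\<theta>. norm (F t \<theta>) powr p) \<le> K * \<phi> t powr p"
  shows "integral {c..d} (\<lambda>\<theta>. norm (integral {a..b} (\<lambda>t. F t \<theta>)) powr p)
    \<le> K * integral {a..b} \<phi> powr p"
proof (cases "a = b")
  case True
  then show ?thesis by simp
next
  case False
  then have ab': "a < b" using ab by simp
  have pos': "0 \<le> \<phi> t" "\<phi> t \<noteq> 0" if "t \<in> {a..b}" for t using pos[OF that] by auto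
  define \<Phi> where "\<Phi> = integral {a..b} \<phi>"
  have i\<phi>: "\<phi> integrable_on {a..b}" using \<phi> by (rule integrable_continuous_interval)
  have \<Phi>0: "0 \<le> \<Phi>" unfolding \<Phi>_def by (intro integral_nonneg i\<phi> pos'(1))
  have swap: "continuous_on ({c..d} \<times> {a..b}) (\<lambda>(\<theta>, t). F t \<theta>)"
    using continuous_on_swap_args[OF F] by simp
  have c1: "continuous_on {c..d} (\<lambda>\<theta>. integral {a..b} (\<lambda>t. F t \<theta>))"
    using integral_continuous_on_param[of "{c..d}" a b "\<lambda>\<theta> t. F t \<theta>"] swap by simp
  let ?G = "\<lambda>t \<theta>. norm (F t \<theta>) powr p * \<phi> t powr (1 - p)"
  have cG: "continuous_on ({a..b} \<times> {c..d}) (\<lambda>(t, \<theta>). ?G t \<theta>)"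
  proof -
    have "continuous_on ({a..b} \<times> {c..d}) (\<lambda>x. \<phi> (fst x))"
      by (rule continuous_on_compose2[OF \<phi>]) (auto intro!: continuous_intros)
    moreover have "continuous_on ({a..b} \<times> {c..d}) (\<lambda>x. F (fst x) (snd x))"
      using F by (simp add: case_prod_unfold)
    ultimately have "continuous_on ({a..b} \<times> {c..d})
        (\<lambda>x. norm (F (fst x) (snd x)) powr p * \<phi> (fst x) powr (1 - p))"
      using p by (intro continuous_on_mult continuous_on_powr continuous_on_powr' continuous_intros) (auto simp: pos')
    then show ?thesis by (simp add: case_prod_unfold)
  qed
  have cG': "continuous_on ({c..d} \<times> {a..b}) (\<lambda>(\<theta>, t). ?G t \<theta>)"
    using continuous_on_swap_args[OF cG] by simp
  have cI: "continuous_on {c..d} (\<lambda>\<theta>. integral {a..b} (\<lambda>t. ?G t \<theta>))"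
    using integral_continuous_on_param[of "{c..d}" a b "\<lambda>\<theta> t. ?G t \<theta>"] cG' by simp
  have cI2: "continuous_on {a..b} (\<lambda>t. integral {c..d} (?G t))"
    using integral_continuous_on_param[of "{a..b}" c d ?G] cG by simp
  have sec: "continuous_on {a..b} (\<lambda>t. F t \<theta>)" if "\<theta> \<in> {c..d}" for \<theta>
  proof -
    have "continuous_on {a..b} (\<lambda>t. case (t, \<theta>) of (t, \<theta>) \<Rightarrow> F t \<theta>)"
      by (rule continuous_on_compose2[OF F]) (use that in \<open>auto intro!: continuous_intros\<close>)
    then show ?thesis by simp
  qed
  have "integral {c..d} (\<lambda>\<theta>. norm (integral {a..b} (\<lambda>t. F t \<theta>)) powr p)
      \<le> integral {c..d} (\<lambda>\<theta>. \<Phi> powr (p - 1) * integral {a..b} (\<lambda>t. ?G t \<theta>))"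
  proof (intro integral_le integrable_continuous_interval)
    show "continuous_on {c..d} (\<lambda>\<theta>. norm (integral {a..b} (\<lambda>t. F t \<theta>)) powr p)"
      using p by (intro continuous_on_powr' continuous_intros c1) auto
    show "continuous_on {c..d} (\<lambda>\<theta>. \<Phi> powr (p - 1) * integral {a..b} (\<lambda>t. ?G t \<theta>))"
      by (intro continuous_intros cI)
    show "norm (integral {a..b} (\<lambda>t. F t \<theta>)) powr p \<le>
        \<Phi> powr (p - 1) * integral {a..b} (\<lambda>t. ?G t \<theta>)" if "\<theta> \<in> {c..d}" for \<theta>
      unfolding \<Phi>_def by (rule norm_integral_powr_le_weighted[OF p ab' sec[OF that] \<phi> pos])
  qed
  also have "\<dots> = \<Phi> powr (p - 1) * integral {a..b} (\<lambda>t. integral {c..d} (?G t))"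
    using integral_swap_continuous[of a c b d ?G] cG by (simp add: cbox_Pair_eq)
  also have "integral {a..b} (\<lambda>t. integral {c..d} (?G t)) \<le> integral {a..b} (\<lambda>t. K * \<phi> t)"
  proof (intro integral_le integrable_continuous_interval cI2)
    show "continuous_on {a..b} (\<lambda>t. K * \<phi> t)" by (intro continuous_intros \<phi>)
    fix t assume t: "t \<in> {a..b}"
    have "integral {c..d} (?G t) = \<phi> t powr (1 - p) * integral {c..d} (\<lambda>\<theta>. norm (F t \<theta>) powr p)"
      by (simp add: mult.commute)
    also have "\<dots> \<le> \<phi> t powr (1 - p) * (K * \<phi> t powr p)"
      using le[OF t] by (intro mult_left_mono) auto
    also have "\<dots> = K * \<phi> t" using pos[OF t] by (simp add: powr_diff)
    finally show "integral {c..d} (?G t) \<le> K * \<phi> t" .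
  qed
  also have "\<Phi> powr (p - 1) * integral {a..b} (\<lambda>t. K * \<phi> t) = K * \<Phi> powr p"
    using \<Phi>0 by (cases "\<Phi> = 0") (auto simp: \<Phi>_def[symmetric] powr_diff)
  finally show ?thesis by (simp add: \<Phi>_def mult_left_mono)
qed

section \<open>Integral means on circles\<close>

lemma integral_mean_nonneg: "0 \<le> integral_mean p r g"
  by (simp add: integral_mean_def)

lemma integral_mean_le_iff:
  assumes "1 \<le> p" "0 \<le> K"
  shows "integral_mean p r g \<le> K \<longleftrightarrow>
    integral {-pi..pi} (\<lambda>\<theta>. norm (g (of_real r * exp (\<i> * of_real \<theta>))) powr p) \<le> 2 * pi * K powr p"
proof -
  have "integral_mean p r g \<le> K \<longleftrightarrow> integral_mean p r g powr p \<le> K powr p"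
    using assms powr_mono2[of p "integral_mean p r g" K] powr_less_mono2[of p K "integral_mean p r g"]
      integral_mean_nonneg[of p r g] by (auto simp: not_le[symmetric])
  then show ?thesis
    unfolding integral_mean_powr[OF assms(1)] by (simp add: field_simps)
qed

lemma integral_periodic_shift:
  fixes g :: "real \<Rightarrow> real"
  assumes g: "continuous_on UNIV g" and per: "\<And>x. g (x + 2 * pi) = g x" and c: "0 \<le> c" "c \<le> 2 * pi"
  shows "integral {-pi..pi} (\<lambda>x. g (x + c)) = integral {-pi..pi} g"
proof -
  have int: "g integrable_on {a..b}" for a b
    by (intro integrable_continuous_interval continuous_on_subset[OF g]) auto
  have "integral {-pi..pi} (\<lambda>x. g (x + c)) = integral {-pi + c..pi + c} g"
    using integral_shift_Icc_real[of "-pi" pi g c] by (simp add: o_def add.commute)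
  also have "\<dots> = integral {-pi + c..pi} g + integral {pi..pi + c} g"
    using c by (intro Henstock_Kurzweil_Integration.integral_combine[symmetric] int) auto
  also have "integral {pi..pi + c} g = integral {-pi..-pi + c} g"
    using integral_shift_Icc_real[of "-pi" "-pi + c" g "2 * pi"]
    by (simp add: o_def per add.commute[of "2 * pi"])
  also have "integral {-pi + c..pi} g + \<dots> = integral {-pi..pi} g"
    using Henstock_Kurzweil_Integration.integral_combine[of "-pi" "-pi + c" pi g] int c by simp
  finally show ?thesis .
qed

text \<open>
  The \<open>L\<^sup>p\<close> mean of the rotations \<open>\<theta> \<mapsto> h (e\<^sup>i\<^sup>\<theta> w)\<close> depends on \<open>w\<close> only through its modulus, since the
  argument of \<open>w\<close> shifts \<open>\<theta>\<close> within the period.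
\<close>

lemma integral_circle_rotate:
  assumes h: "continuous_on (ball 0 1) h" and w: "norm w < 1" and p: "1 \<le> p"
  shows "integral {-pi..pi} (\<lambda>\<theta>. norm (h (exp (\<i> * of_real \<theta>) * w)) powr p)
    = integral {-pi..pi} (\<lambda>\<theta>. norm (h (of_real (norm w) * exp (\<i> * of_real \<theta>))) powr p)"
proof -
  define g where "g = (\<lambda>\<theta>. norm (h (of_real (norm w) * exp (\<i> * of_real \<theta>))) powr p)"
  have "continuous_on UNIV (\<lambda>\<theta>::real. h (of_real (norm w) * exp (\<i> * of_real \<theta>)))"
    by (rule continuous_on_compose2[OF h]) (use w in \<open>auto intro!: continuous_intros simp: norm_mult\<close>)
  then have g: "continuous_on UNIV g"
    unfolding g_def using p by (intro continuous_on_powr' continuous_intros) auto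
  have per: "g (x + 2 * pi) = g x" for x
  proof -
    have "exp (\<i> * of_real (x + 2 * pi)) = exp (\<i> * of_real x)"
      by (simp add: distrib_left exp_add exp_two_pi_i' mult.commute[of 2])
    then show ?thesis unfolding g_def by simp
  qed
  have "exp (\<i> * of_real \<theta>) * w = of_real (norm w) * exp (\<i> * of_real (\<theta> + Arg2pi w))" for \<theta>
    using Arg2pi_eq[of w] by (simp add: distrib_left exp_add mult_ac)
  then show ?thesis
    using integral_periodic_shift[OF g per Arg2pi_ge_0[of w] less_imp_le[OF Arg2pi_lt_2pi[of w]]]
    unfolding g_def by simp
qed

text \<open>
  With \<open>A\<close> and \<open>B\<close> slightly above the two means, \<open>x + y\<close> is the convex combination of \<open>x / A\<close> and \<open>y / B\<close> with weights
  \<open>A / (A + B)\<close> and \<open>B / (A + B)\<close>, multiplied by \<open>A + B\<close>. The tangent inequality for the two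
  pieces therefore gives a pointwise estimate whose mean is at most \<open>(A + B) powr p\<close>.
\<close>

lemma integral_mean_triangle:
  assumes p: "1 \<le> p" and r: "0 \<le> r" "r < 1"
    and u: "u holomorphic_on ball 0 1" and v: "v holomorphic_on ball 0 1"
  shows "integral_mean p r (\<lambda>z. u z + v z) \<le> integral_mean p r u + integral_mean p r v"
proof (rule field_le_epsilon)
  fix \<epsilon> :: real assume \<epsilon>: "0 < \<epsilon>"
  (* The weights A and B must be positive even if u or v vanishes. *)
  define A where "A = integral_mean p r u + \<epsilon> / 2"
  define B where "B = integral_mean p r v + \<epsilon> / 2"
  have A: "0 < A" and B: "0 < B"
    using integral_mean_nonneg[of p r u] integral_mean_nonneg[of p r v] \<epsilon>
    by (auto simp: A_def B_def intro: add_nonneg_pos)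
  let ?I = "\<lambda>g. integral {-pi..pi} (\<lambda>\<theta>. norm (g (of_real r * exp (\<i> * of_real \<theta>))) powr p)"
  have uA: "?I u \<le> 2 * pi * A powr p" and vB: "?I v \<le> 2 * pi * B powr p"
    using integral_mean_le_iff[of p A r u] integral_mean_le_iff[of p B r v] p A B \<epsilon>
    by (auto simp: A_def B_def)
  have ui: "(\<lambda>\<theta>. norm (u (of_real r * exp (\<i> * of_real \<theta>))) powr p) integrable_on {-pi..pi}"
    and vi: "(\<lambda>\<theta>. norm (v (of_real r * exp (\<i> * of_real \<theta>))) powr p) integrable_on {-pi..pi}"
    by (intro integrand_integrable u v r p)+
  have conv: "norm (x + y) powr p \<le>
      (A + B) powr (p - 1) * (norm x powr p * A powr (1 - p) + norm y powr p * B powr (1 - p))"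
    for x y :: complex
  proof (cases "norm x + norm y = 0")
    case True
    then show ?thesis using p by (simp add: add_nonneg_eq_0_iff)
  next
    case False
    define s where "s = norm x + norm y"
    define m where "m = s / (A + B)"
    have s: "0 < s" using False by (simp add: s_def add_nonneg_pos less_le)
    have m: "0 < m" using s A B by (simp add: m_def)
    have tan: "p * m powr (p - 1) * norm z \<le> norm z powr p * D powr (1 - p) + (p * m powr p * D - m powr p * D)"
      if D: "0 < D" for z :: complex and D
      using powr_tangent_le[OF p m norm_ge_zero D, of z] by (simp add: algebra_simps)
    have "p * m powr (p - 1) * norm x + p * m powr (p - 1) * norm y = p * m powr (p - 1) * s"
      by (simp add: s_def distrib_left)
    also have "\<dots> = p * m powr p * A + p * m powr p * B"
      using s A B by (simp add: m_def powr_diff distrib_left[symmetric])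
    finally have "m powr p * A + m powr p * B
        \<le> norm x powr p * A powr (1 - p) + norm y powr p * B powr (1 - p)"
      using tan[OF A, of x] tan[OF B, of y] by linarith
    then have "m powr p * (A + B) \<le> norm x powr p * A powr (1 - p) + norm y powr p * B powr (1 - p)"
      by (simp add: distrib_left)
    then have "(A + B) powr (p - 1) * (m powr p * (A + B)) \<le>
      (A + B) powr (p - 1) * (norm x powr p * A powr (1 - p) + norm y powr p * B powr (1 - p))"
      by (intro mult_left_mono) auto
    moreover have "(A + B) powr (p - 1) * (m powr p * (A + B)) = s powr p"
      using s A B by (simp add: m_def powr_divide powr_diff)
    moreover have "norm (x + y) powr p \<le> s powr p"
      using p norm_triangle_ineq[of x y] unfolding s_def by (intro powr_mono2) auto
    ultimately show ?thesis by linarith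
  qed
  have "?I (\<lambda>z. u z + v z) \<le> integral {-pi..pi} (\<lambda>\<theta>. (A + B) powr (p - 1) *
      (norm (u (of_real r * exp (\<i> * of_real \<theta>))) powr p * A powr (1 - p)
       + norm (v (of_real r * exp (\<i> * of_real \<theta>))) powr p * B powr (1 - p)))"
    by (intro integral_le conv integrand_integrable[OF holomorphic_on_add[OF u v] r p]
        integrable_on_mult_right integrable_on_mult_left integrable_add ui vi)
  also have "\<dots> = (A + B) powr (p - 1) * (?I u * A powr (1 - p) + ?I v * B powr (1 - p))"
    using ui vi by (simp add: Henstock_Kurzweil_Integration.integral_add integrable_on_mult_left)
  also have "\<dots> \<le> (A + B) powr (p - 1) *
      (2 * pi * A powr p * A powr (1 - p) + 2 * pi * B powr p * B powr (1 - p))"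
    by (intro mult_left_mono add_mono mult_right_mono uA vB) auto
  also have "\<dots> = (A + B) powr (p - 1) * (2 * pi * (A + B))"
    using A B by (simp add: mult.assoc powr_add[symmetric] distrib_left)
  also have "\<dots> = 2 * pi * (A + B) powr p"
    using A B by (simp add: powr_diff)
  finally have "integral_mean p r (\<lambda>z. u z + v z) \<le> A + B"
    using A B by (subst integral_mean_le_iff[OF p]) auto
  then show "integral_mean p r (\<lambda>z. u z + v z) \<le> integral_mean p r u + integral_mean p r v + \<epsilon>"
    by (simp add: A_def B_def)
qed

lemma integral_mean_locally_bounded:
  assumes p: "1 \<le> p" and g: "g holomorphic_on ball 0 1" and R: "R < 1"
  shows "\<exists>B>0. \<forall>r. 0 \<le> r \<and> r \<le> R \<longrightarrow> integral_mean p r g \<le> B"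
proof -
  have "compact (g ` cball 0 R)"
    using R by (intro compact_continuous_image continuous_on_subset[OF holomorphic_on_imp_continuous_on[OF g]])
      auto
  then obtain B where B: "0 < B" "\<And>z. z \<in> cball 0 R \<Longrightarrow> norm (g z) \<le> B"
    by (auto dest!: compact_imp_bounded simp: bounded_pos)
  have "integral_mean p r g \<le> B" if r: "0 \<le> r" "r \<le> R" for r
  proof -
    have "integral {-pi..pi} (\<lambda>\<theta>. norm (g (of_real r * exp (\<i> * of_real \<theta>))) powr p)
        \<le> integral {-pi..pi} (\<lambda>\<theta>::real. B powr p)"
      using r R p by (intro integral_le integrand_integrable[OF g] powr_mono2 B(2))
        (auto simp: norm_mult)
    then show ?thesis using B(1) by (subst integral_mean_le_iff[OF p]) auto
  qed
  with B(1) show ?thesis by blast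
qed

lemma holomorphic_on_dilation:
  assumes f: "f holomorphic_on ball 0 1" and r: "0 \<le> r" "r \<le> 1"
  shows "dilation r f holomorphic_on ball 0 1"
proof -
  have "norm (of_real r * z) < 1" if "norm z < 1" for z :: complex
    using r that mult_left_le_one_le[of "norm z" r] by (simp add: norm_mult)
  then have "(f \<circ> (\<lambda>z. of_real r * z)) holomorphic_on ball 0 1"
    by (intro holomorphic_on_compose_gen[OF _ f] holomorphic_intros) auto
  then show ?thesis by (simp add: dilation_def o_def)
qed

lemma integral_mean_le_hardy_norm:
  assumes "g \<in> hardy_space p" "0 \<le> r" "r < 1"
  shows "integral_mean p r g \<le> hardy_norm p g"
  unfolding hardy_norm_def using assms by (intro cSUP_upper) (auto simp: hardy_space_def)

lemma hardy_norm_nonneg: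
  assumes "g \<in> hardy_space p"
  shows "0 \<le> hardy_norm p g"
proof -
  have "0 \<le> integral_mean p 0 g" by (rule integral_mean_nonneg)
  also have "\<dots> \<le> hardy_norm p g" by (rule integral_mean_le_hardy_norm[OF assms]) auto
  finally show ?thesis .
qed

lemma hardy_norm_leI:
  assumes "\<And>r. 0 \<le> r \<Longrightarrow> r < 1 \<Longrightarrow> integral_mean p r g \<le> K"
  shows "hardy_norm p g \<le> K"
  unfolding hardy_norm_def using assms by (intro cSUP_least) auto

section \<open>The mean of the derivative through Cauchy's formula\<close>

text \<open>
  Cauchy's formula over the circle of radius \<open>d\<close> about \<open>\<rho>\<close>, applied to the rotated function
  \<open>v \<mapsto> h (e\<^sup>i\<^sup>\<theta> v)\<close>, exhibits \<open>e\<^sup>i\<^sup>\<theta> h' (\<rho> e\<^sup>i\<^sup>\<theta>)\<close> as an average over \<open>t\<close> of the values of \<open>h / d\<close> at the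
  points \<open>e\<^sup>i\<^sup>\<theta> w t\<close>, up to unimodular factors. For fixed \<open>t\<close> these points are the rotations of one point,
  so the values have \<open>p\<close>-mean at most \<open>N / d\<close> in \<open>\<theta>\<close>, and Minkowski's integral inequality passes
  the bound on to the average.
\<close>

lemma integral_mean_deriv_le_Cauchy:
  assumes p: "1 \<le> p" and h: "h holomorphic_on ball 0 1"
    and \<rho>: "0 \<le> \<rho>" and d: "0 < d" "\<rho> + d < 1" and N: "0 \<le> N"
    and le: "\<And>s. 0 \<le> s \<Longrightarrow> s < 1 \<Longrightarrow> integral_mean p s h \<le> N"
  shows "integral_mean p \<rho> (deriv h) \<le> N / d"
proof -
  define w where "w = (\<lambda>t::real. of_real \<rho> + of_real d * exp (2 * of_real pi * \<i> * of_real t) :: complex)"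
  define F where "F = (\<lambda>(t::real) (\<theta>::real).
      h (exp (\<i> * of_real \<theta>) * w t) / (of_real d * exp (2 * of_real pi * \<i> * of_real t)))"
  have n1: "norm (exp (2 * of_real pi * \<i> * of_real t)) = 1" for t :: real
    by (simp add: norm_exp_eq_Re)
  have w1: "norm (w t) < 1" for t
    using norm_triangle_ineq[of "of_real \<rho>" "of_real d * exp (2 * of_real pi * \<i> * of_real t)"] \<rho> d
    unfolding w_def by (simp add: norm_mult n1)
  have hc: "continuous_on (ball 0 1) h" using h by (rule holomorphic_on_imp_continuous_on)
  have Cauchy: "exp (\<i> * of_real \<theta>) * deriv h (of_real \<rho> * exp (\<i> * of_real \<theta>)) = integral {0..1} (\<lambda>t. F t \<theta>)"
    for \<theta> :: real
  proof -
    define e where "e = exp (\<i> * of_real \<theta>)"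
    have e: "norm e = 1" "e \<noteq> 0" by (auto simp: e_def)
    define k where "k = (\<lambda>v. h (e * v))"
    have "(h \<circ> (\<lambda>v. e * v)) holomorphic_on ball 0 1"
      by (intro holomorphic_on_compose_gen[OF _ h] holomorphic_intros) (auto simp: norm_mult e)
    then have k: "k holomorphic_on ball 0 1" by (simp add: k_def o_def)
    have sub: "cball (of_real \<rho>) d \<subseteq> ball (0::complex) 1"
      using \<rho> d by (subst cball_subset_ball_iff) (auto simp: dist_norm)
    have 1: "((\<lambda>u. k u / (u - of_real \<rho>) ^ 2) has_contour_integral
        (2 * pi * \<i>) * deriv k (of_real \<rho>)) (circlepath (of_real \<rho>) d)"
      using Cauchy_has_contour_integral_higher_derivative_circlepath[of "of_real \<rho>" d k "of_real \<rho>" 1]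
        continuous_on_subset[OF holomorphic_on_imp_continuous_on[OF k] sub]
        holomorphic_on_subset[OF k order_trans[OF ball_subset_cball sub]] d
      by (simp add: power2_eq_square)
    have "(h has_field_derivative deriv h (e * of_real \<rho>)) (at (e * of_real \<rho>))"
      using \<rho> d e by (intro holomorphic_derivI[OF h]) (auto simp: norm_mult)
    then have "(k has_field_derivative deriv h (e * of_real \<rho>) * e) (at (of_real \<rho>))"
      unfolding k_def by (rule DERIV_chain2) (auto intro!: derivative_eq_intros)
    then have dk: "deriv k (of_real \<rho>) = e * deriv h (of_real \<rho> * e)"
      using DERIV_imp_deriv by (simp add: mult.commute)
    have "((\<lambda>t. (2 * pi * \<i>) * F t \<theta>) has_integral (2 * pi * \<i>) * deriv k (of_real \<rho>)) {0..1}"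
    proof (rule has_integral_eq[OF _ 1[unfolded has_contour_integral_def]])
      fix t :: real assume "t \<in> {0..1}"
      then have "vector_derivative (circlepath (of_real \<rho>) d) (at t within {0..1}) =
          2 * pi * \<i> * d * exp (2 * of_real pi * \<i> * t)"
        by (intro vector_derivative_circlepath01) auto
      then show "k (circlepath (of_real \<rho>) d t) / (circlepath (of_real \<rho>) d t - of_real \<rho>)\<^sup>2 *
          vector_derivative (circlepath (of_real \<rho>) d) (at t within {0..1}) = 2 * pi * \<i> * F t \<theta>"
        using d by (simp add: circlepath F_def w_def k_def e_def[symmetric] power2_eq_square)
    qed
    then have "((\<lambda>t. F t \<theta>) has_integral deriv k (of_real \<rho>)) {0..1}"
      by (subst (asm) has_integral_mult_right_iff) auto
    then show ?thesis using dk by (simp add: integral_unique e_def)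
  qed
  have "integral {-pi..pi} (\<lambda>\<theta>. norm (deriv h (of_real \<rho> * exp (\<i> * of_real \<theta>))) powr p)
      = integral {-pi..pi} (\<lambda>\<theta>. norm (integral {0..1} (\<lambda>t. F t \<theta>)) powr p)"
    by (simp add: Cauchy[symmetric] norm_mult)
  (* The summand \<epsilon> keeps the weight positive when N = 0. *)
  also have "\<dots> \<le> (2 * pi) * integral {0..1} (\<lambda>t::real. N / d + \<epsilon>) powr p" if \<epsilon>: "0 < \<epsilon>" for \<epsilon>
  proof (rule Minkowski_integral_weighted[OF p])
    have "continuous_on ({0..1} \<times> {-pi..pi}) (\<lambda>x. h (exp (\<i> * of_real (snd x)) * w (fst x)))"
      by (rule continuous_on_compose2[OF hc])
        (use w1 in \<open>auto intro!: continuous_intros simp: norm_mult w_def\<close>)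
    then show "continuous_on ({0..1} \<times> {-pi..pi}) (\<lambda>(t, \<theta>). F t \<theta>)"
      unfolding F_def case_prod_unfold using d by (intro continuous_intros) auto
    show "0 < N / d + \<epsilon>" using N d \<epsilon> by (simp add: add_nonneg_pos)
    fix t :: real assume "t \<in> {0..1}"
    have "integral {-pi..pi} (\<lambda>\<theta>. norm (F t \<theta>) powr p)
        = integral {-pi..pi} (\<lambda>\<theta>. norm (h (exp (\<i> * of_real \<theta>) * w t)) powr p / d powr p)"
      using d by (simp add: F_def norm_divide norm_mult n1 powr_divide)
    also have "\<dots> = integral {-pi..pi} (\<lambda>\<theta>. norm (h (of_real (norm (w t)) * exp (\<i> * of_real \<theta>))) powr p) / d powr p"
      using integral_circle_rotate[OF hc w1 p] by simp
    also have "\<dots> \<le> 2 * pi * N powr p / d powr p"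
      using le[OF norm_ge_zero w1, of t] unfolding integral_mean_le_iff[OF p N]
      by (intro divide_right_mono) auto
    also have "\<dots> = 2 * pi * (N / d) powr p" using N d by (simp add: powr_divide)
    also have "\<dots> \<le> 2 * pi * (N / d + \<epsilon>) powr p"
      using N d \<epsilon> p by (intro mult_left_mono powr_mono2) auto
    finally show "integral {-pi..pi} (\<lambda>\<theta>. norm (F t \<theta>) powr p) \<le> 2 * pi * (N / d + \<epsilon>) powr p" .
  qed auto
  finally have "integral_mean p \<rho> (deriv h) \<le> N / d + \<epsilon>" if "0 < \<epsilon>" for \<epsilon>
    using that N d p by (subst integral_mean_le_iff) auto
  then show ?thesis by (rule field_le_epsilon)
qed

section \<open>From the derivative to the dilations\<close>

lemma powr_add_le:
  fixes x y a :: real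
  assumes "0 \<le> x" "0 \<le> y" "a \<le> 1"
  shows "(x + y) powr a \<le> x powr a + y powr a"
proof (cases "x + y = 0")
  case False
  then have s: "0 < x + y" using assms by simp
  have *: "z \<le> z powr a" if "0 \<le> z" "z \<le> 1" for z :: real
    using powr_mono'[of a 1 z] that assms by simp
  have "1 = x / (x + y) + y / (x + y)" using s by (simp add: add_divide_distrib[symmetric])
  also have "\<dots> \<le> (x / (x + y)) powr a + (y / (x + y)) powr a"
    using assms s by (intro add_mono *) auto
  also have "\<dots> = (x powr a + y powr a) / (x + y) powr a"
    using assms s by (simp add: powr_divide add_divide_distrib)
  finally show ?thesis using s by (simp add: field_simps)
qed (use assms in simp)

text \<open>
  The radial segment is parametrised by the modulus \<open>t\<close> of its points, which runs from \<open>r \<rho>\<close> to \<open>\<rho>\<close>, so that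
  the weight \<open>(1 - t) powr (\<alpha> - 1)\<close> stays continuous, although for \<open>\<alpha> < 1\<close> it is singular at \<open>1\<close>. Its
  integral is at most the one over \<open>{r..1}\<close>, because \<open>powr \<alpha>\<close> is subadditive.
\<close>

lemma integral_mean_dilation_diff_le:
  assumes p: "1 \<le> p" and \<alpha>: "0 < \<alpha>" "\<alpha> \<le> 1" and f: "f holomorphic_on ball 0 1" and C: "0 < C"
    and le: "\<And>s. 0 \<le> s \<Longrightarrow> s < 1 \<Longrightarrow> integral_mean p s (deriv f) \<le> C * (1 - s) powr (\<alpha> - 1)"
    and r: "0 \<le> r" "r < 1" and \<rho>: "0 \<le> \<rho>" "\<rho> < 1"
  shows "integral_mean p \<rho> (\<lambda>z. dilation r f z - f z) \<le> C / \<alpha> * (1 - r) powr \<alpha>"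
proof -
  define \<phi> where "\<phi> = (\<lambda>t. C * (1 - t) powr (\<alpha> - 1))"
  define F where "F = (\<lambda>t \<theta>. deriv f (of_real t * exp (\<i> * of_real \<theta>)) * exp (\<i> * of_real \<theta>))"
  have r\<rho>: "0 \<le> r * \<rho>" "r * \<rho> \<le> \<rho>" using r \<rho> by (auto simp: mult_left_le_one_le)
  have f': "deriv f holomorphic_on ball 0 1" by (intro holomorphic_deriv f) auto
  have FTC: "integral {r * \<rho>..\<rho>} (\<lambda>t. F t \<theta>) =
      f (of_real \<rho> * exp (\<i> * of_real \<theta>)) - f (of_real (r * \<rho>) * exp (\<i> * of_real \<theta>))" for \<theta>
  proof (rule integral_unique, rule fundamental_theorem_of_calculus[OF r\<rho>(2)])
    fix t assume t: "t \<in> {r * \<rho>..\<rho>}"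
    have "norm (of_real t * exp (\<i> * of_real \<theta>)) < 1"
      using t r\<rho> \<rho> by (simp add: norm_mult)
    then have D: "(f has_field_derivative deriv f (of_real t * exp (\<i> * of_real \<theta>)))
        (at (of_real t * exp (\<i> * of_real \<theta>)))"
      by (intro holomorphic_derivI[OF f]) auto
    have "((\<lambda>x. of_real x * exp (\<i> * of_real \<theta>)) has_vector_derivative exp (\<i> * of_real \<theta>))
        (at t within {r * \<rho>..\<rho>})"
      by (auto intro!: derivative_eq_intros simp: has_vector_derivative_def scaleR_conv_of_real)
    from field_vector_diff_chain_within[OF this has_field_derivative_at_within[OF D]]
    show "((\<lambda>x. f (of_real x * exp (\<i> * of_real \<theta>))) has_vector_derivative F t \<theta>)
        (at t within {r * \<rho>..\<rho>})"
      by (simp add: F_def o_def mult.commute)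
  qed
  have \<phi>_int: "(\<phi> has_integral (- C / \<alpha> * (1 - \<rho>) powr \<alpha>) - (- C / \<alpha> * (1 - r * \<rho>) powr \<alpha>)) {r * \<rho>..\<rho>}"
  proof (rule fundamental_theorem_of_calculus[OF r\<rho>(2)])
    fix t assume t: "t \<in> {r * \<rho>..\<rho>}"
    show "((\<lambda>t. - C / \<alpha> * (1 - t) powr \<alpha>) has_vector_derivative \<phi> t) (at t within {r * \<rho>..\<rho>})"
      unfolding has_real_derivative_iff_has_vector_derivative[symmetric] \<phi>_def
      using t \<rho> \<alpha> by (auto intro!: derivative_eq_intros simp: powr_diff field_simps)
  qed
  then have I\<phi>: "integral {r * \<rho>..\<rho>} \<phi> = C / \<alpha> * ((1 - r * \<rho>) powr \<alpha> - (1 - \<rho>) powr \<alpha>)"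
    by (simp add: integral_unique algebra_simps diff_divide_distrib)
  have "(1 - r * \<rho>) powr \<alpha> = ((\<rho> - r * \<rho>) + (1 - \<rho>)) powr \<alpha>" by simp
  also have "\<dots> \<le> (\<rho> - r * \<rho>) powr \<alpha> + (1 - \<rho>) powr \<alpha>"
    using r\<rho> \<rho> \<alpha> by (intro powr_add_le) auto
  also have "\<rho> - r * \<rho> \<le> 1 - r" using r \<rho> mult_left_le_one_le[of "1 - r" \<rho>] by (simp add: algebra_simps)
  then have "(\<rho> - r * \<rho>) powr \<alpha> \<le> (1 - r) powr \<alpha>" using r\<rho> \<alpha> by (intro powr_mono2) auto
  finally have "integral {r * \<rho>..\<rho>} \<phi> \<le> C / \<alpha> * (1 - r) powr \<alpha>"
    unfolding I\<phi> using C \<alpha> by (intro mult_left_mono) auto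
  moreover have "0 \<le> integral {r * \<rho>..\<rho>} \<phi>"
    using C by (intro integral_nonneg has_integral_integrable[OF \<phi>_int]) (simp add: \<phi>_def)
  ultimately have I\<phi>p: "integral {r * \<rho>..\<rho>} \<phi> powr p \<le> (C / \<alpha> * (1 - r) powr \<alpha>) powr p"
    using p by (intro powr_mono2) auto
  have "integral {-pi..pi} (\<lambda>\<theta>. norm (integral {r * \<rho>..\<rho>} (\<lambda>t. F t \<theta>)) powr p)
      \<le> 2 * pi * integral {r * \<rho>..\<rho>} \<phi> powr p"
  proof (rule Minkowski_integral_weighted[OF p r\<rho>(2)])
    have "continuous_on ({r * \<rho>..\<rho>} \<times> {-pi..pi}) (\<lambda>x. deriv f (of_real (fst x) * exp (\<i> * of_real (snd x))))"
      by (rule continuous_on_compose2[OF holomorphic_on_imp_continuous_on[OF f']])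
        (use r\<rho> \<rho> in \<open>auto intro!: continuous_intros simp: norm_mult\<close>)
    then show "continuous_on ({r * \<rho>..\<rho>} \<times> {-pi..pi}) (\<lambda>(t, \<theta>). F t \<theta>)"
      unfolding F_def case_prod_unfold by (intro continuous_intros)
    show "continuous_on {r * \<rho>..\<rho>} \<phi>"
      unfolding \<phi>_def using \<rho> by (intro continuous_intros) auto
    fix t assume t: "t \<in> {r * \<rho>..\<rho>}"
    show \<phi>t: "0 < \<phi> t" using t C \<rho> by (simp add: \<phi>_def)
    show "integral {-pi..pi} (\<lambda>\<theta>. norm (F t \<theta>) powr p) \<le> 2 * pi * \<phi> t powr p"
      using le[of t] t r\<rho> \<rho> integral_mean_le_iff[OF p less_imp_le[OF \<phi>t], of t "deriv f"]
      by (simp add: F_def norm_mult \<phi>_def)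
  qed
  also have "\<dots> \<le> 2 * pi * (C / \<alpha> * (1 - r) powr \<alpha>) powr p"
    using I\<phi>p by simp
  finally show ?thesis
    using C \<alpha> by (subst integral_mean_le_iff[OF p])
      (auto simp: FTC dilation_def norm_minus_commute mult.assoc)
qed

text \<open>
  On a disc of radius less than \<open>1\<close> the means of \<open>f'\<close> are bounded, and \<open>(1 - s) powr (\<alpha> - 1) \<ge> 1\<close>,
  so the asymptotic bound holds on the whole of \<open>{0..<1}\<close> with a larger constant. This is needed because the
  Hardy norm of \<open>f\<^sub>r - f\<close> involves circles of every radius.
\<close>

lemma hardy_norm_dilation_diff_bigo:
  assumes p: "1 \<le> p" and \<alpha>: "0 < \<alpha>" "\<alpha> \<le> 1" and f: "f \<in> hardy_space p"
    and O: "(\<lambda>r. integral_mean p r (deriv f)) \<in> O[at_left 1](\<lambda>r. (1 - r) powr (\<alpha> - 1))"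
  shows "(\<lambda>r. hardy_norm p (\<lambda>z. dilation r f z - f z)) \<in> O[at_left 1](\<lambda>r. (1 - r) powr \<alpha>)"
proof -
  have hf: "f holomorphic_on ball 0 1" using f by (simp add: hardy_space_def)
  from O obtain c where c: "c > 0" and
    "eventually (\<lambda>r. norm (integral_mean p r (deriv f)) \<le> c * norm ((1 - r) powr (\<alpha> - 1))) (at_left 1)"
    by (elim landau_o.bigE)
  then obtain b where b: "b < 1" "\<And>r. b < r \<Longrightarrow> r < 1 \<Longrightarrow>
      norm (integral_mean p r (deriv f)) \<le> c * norm ((1 - r) powr (\<alpha> - 1))"
    by (auto simp: eventually_at_left[of 0 "1::real"])
  have "deriv f holomorphic_on ball 0 1" by (intro holomorphic_deriv hf) auto
  from integral_mean_locally_bounded[OF p this b(1)] obtain B where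
    B: "0 < B" "\<And>r. 0 \<le> r \<Longrightarrow> r \<le> b \<Longrightarrow> integral_mean p r (deriv f) \<le> B" by blast
  define C where "C = max c B"
  have C: "0 < C" using c by (simp add: C_def)
  have le: "integral_mean p s (deriv f) \<le> C * (1 - s) powr (\<alpha> - 1)" if s: "0 \<le> s" "s < 1" for s
  proof (cases "s \<le> b")
    case True
    have "1 \<le> (1 - s) powr (\<alpha> - 1)"
      using s \<alpha> powr_mono2'[of "\<alpha> - 1" "1 - s" 1] by simp
    then have "B * 1 \<le> C * (1 - s) powr (\<alpha> - 1)"
      using B(1) by (intro mult_mono) (auto simp: C_def)
    then show ?thesis using B(2)[OF s(1) True] by simp
  next
    case False
    then have "integral_mean p s (deriv f) \<le> c * (1 - s) powr (\<alpha> - 1)"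
      using b(2)[of s] s by simp
    also have "\<dots> \<le> C * (1 - s) powr (\<alpha> - 1)"
      by (intro mult_right_mono) (auto simp: C_def)
    finally show ?thesis .
  qed
  have "norm (hardy_norm p (\<lambda>z. dilation r f z - f z)) \<le> C / \<alpha> * norm ((1 - r) powr \<alpha>)"
    if r: "0 < r" "r < 1" for r
    using r hardy_norm_nonneg[OF dilation_diff_in_hardy_space[OF p f, of r]]
      hardy_norm_leI[of p "\<lambda>z. dilation r f z - f z", OF integral_mean_dilation_diff_le[OF p \<alpha> hf C le, of r]]
    by simp
  then show ?thesis
    by (intro landau_o.bigI[of "C / \<alpha>"])
      (use C \<alpha> in \<open>auto simp: eventually_at_left[of 0 "1::real"] intro!: exI[of _ 0]\<close>)
qed

section \<open>From the dilations to the derivative\<close>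

text \<open>
  The case \<open>\<alpha> = 1\<close>: as \<open>r\<close> tends to \<open>1\<close>, the quotients \<open>(f (r z) - f z) / (r - 1)\<close> converge to \<open>z f' z\<close>,
  and on the circle of radius \<open>\<rho>\<close> they are bounded by the maximum of \<open>norm f'\<close> on the closed disc. Hence their
  \<open>p\<close>-means converge, and the bound \<open>C\<close> is inherited by \<open>z f' z\<close>, where \<open>norm z = \<rho>\<close>.
\<close>

lemma integral_mean_deriv_le_difference_quotient:
  assumes p: "1 \<le> p" and f: "f holomorphic_on ball 0 1" and C: "0 \<le> C" and r0: "r0 < 1"
    and le: "\<And>r. r0 < r \<Longrightarrow> 0 \<le> r \<Longrightarrow> r < 1 \<Longrightarrow> integral_mean p \<rho> (\<lambda>z. dilation r f z - f z) \<le> C * (1 - r)"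
    and \<rho>: "0 < \<rho>" "\<rho> < 1"
  shows "integral_mean p \<rho> (deriv f) \<le> C / \<rho>"
proof -
  define r where "r = (\<lambda>n. 1 - (1 - max r0 0) * inverse (real (Suc (Suc n))))"
  have rn: "r0 < r n" "0 \<le> r n" "r n < 1" for n
  proof -
    have "0 < inverse (real (Suc (Suc n)))" "inverse (real (Suc (Suc n))) < 1"
      by (auto simp: field_simps)
    moreover have "0 < 1 - max r0 0" using r0 by simp
    ultimately have "0 < (1 - max r0 0) * inverse (real (Suc (Suc n)))"
        "(1 - max r0 0) * inverse (real (Suc (Suc n))) < 1 - max r0 0"
      by (auto simp del: of_nat_Suc)
    then show "r0 < r n" "0 \<le> r n" "r n < 1" unfolding r_def by linarith+
  qed
  have rlim: "r \<longlonglongrightarrow> 1"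
  proof -
    have "(\<lambda>n. inverse (real (Suc (Suc n)))) \<longlonglongrightarrow> 0"
      using LIMSEQ_Suc[OF LIMSEQ_inverse_real_of_nat] .
    then have "r \<longlonglongrightarrow> 1 - (1 - max r0 0) * 0" unfolding r_def by (intro tendsto_intros)
    then show ?thesis by simp
  qed
  define z where "z = (\<lambda>\<theta>::real. of_real \<rho> * exp (\<i> * of_real \<theta>) :: complex)"
  have nz: "norm (z \<theta>) = \<rho>" for \<theta> using \<rho> by (simp add: z_def norm_mult)
  define q where "q = (\<lambda>n \<theta>. norm ((f (of_real (r n) * z \<theta>) - f (z \<theta>)) / (of_real (r n) - 1)) powr p)"
  have f': "deriv f holomorphic_on ball 0 1" by (intro holomorphic_deriv f) auto
  have "compact (deriv f ` cball 0 \<rho>)"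
    using \<rho> by (intro compact_continuous_image continuous_on_subset[OF holomorphic_on_imp_continuous_on[OF f']])
      auto
  then obtain B where B: "0 < B" "\<And>z. z \<in> cball 0 \<rho> \<Longrightarrow> norm (deriv f z) \<le> B"
    by (auto dest!: compact_imp_bounded simp: bounded_pos)
  have n1: "norm (of_real (r n) - 1 :: complex) = 1 - r n" for n
    using rn[of n] by (metis abs_minus_commute abs_of_pos diff_gt_0_iff_gt norm_of_real of_real_1 of_real_diff)
  have q_le: "q n \<theta> \<le> B powr p" for n \<theta>
  proof -
    have "norm (f (of_real (r n) * z \<theta>) - f (z \<theta>)) \<le> B * norm (of_real (r n) * z \<theta> - z \<theta>)"
    proof (rule field_differentiable_bound[of "cball 0 \<rho>" f "deriv f"])
      show "(f has_field_derivative deriv f x) (at x within cball 0 \<rho>)" if "x \<in> cball 0 \<rho>" for x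
        using that \<rho> by (intro has_field_derivative_at_within[OF holomorphic_derivI[OF f]]) auto
      show "of_real (r n) * z \<theta> \<in> cball 0 \<rho>"
        using rn[of n] \<rho> by (simp add: norm_mult nz mult_left_le_one_le)
    qed (use B nz in auto)
    also have "of_real (r n) * z \<theta> - z \<theta> = (of_real (r n) - 1) * z \<theta>" by (simp add: algebra_simps)
    also have "norm \<dots> \<le> (1 - r n) * 1" unfolding norm_mult n1 nz using rn[of n] \<rho> by (intro mult_left_mono) auto
    finally have "norm ((f (of_real (r n) * z \<theta>) - f (z \<theta>)) / (of_real (r n) - 1)) \<le> B"
      using rn[of n] B(1) by (simp add: norm_divide n1 field_simps)
    then show ?thesis unfolding q_def using p by (intro powr_mono2) auto
  qed
  have q_lim: "(\<lambda>n. q n \<theta>) \<longlonglongrightarrow> norm (deriv f (z \<theta>) * z \<theta>) powr p" for \<theta>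
  proof -
    have "(f has_field_derivative deriv f (z \<theta>)) (at (1 * z \<theta>))"
      using holomorphic_derivI[OF f, of "z \<theta>"] nz \<rho> by simp
    then have "((\<lambda>y. f (y * z \<theta>)) has_field_derivative deriv f (z \<theta>) * z \<theta>) (at 1)"
      by (rule DERIV_chain2) (auto intro!: derivative_eq_intros)
    then have lim: "((\<lambda>y. (f (y * z \<theta>) - f (z \<theta>)) / (y - 1)) \<longlongrightarrow> deriv f (z \<theta>) * z \<theta>) (at 1)"
      by (simp add: has_field_derivative_iff)
    moreover have "(\<lambda>n. of_real (r n) :: complex) \<longlonglongrightarrow> 1"
      using tendsto_of_real[OF rlim] by simp
    moreover have "of_real (r n) \<noteq> (1 :: complex)" for n using rn(3)[of n] by simp
    ultimately have "(\<lambda>n. (f (of_real (r n) * z \<theta>) - f (z \<theta>)) / (of_real (r n) - 1)) \<longlonglongrightarrow> deriv f (z \<theta>) * z \<theta>"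
      using lim[unfolded LIMSEQ_SEQ_conv[symmetric], rule_format, of "\<lambda>n. of_real (r n)"] by simp
    then show ?thesis unfolding q_def using p by (intro tendsto_powr' tendsto_norm tendsto_const) auto
  qed
  have q_eq: "q n = (\<lambda>\<theta>. norm (dilation (r n) f (z \<theta>) - f (z \<theta>)) powr p / (1 - r n) powr p)" for n
    using rn[of n] by (auto simp: q_def dilation_def norm_divide n1 powr_divide)
  have hol: "(\<lambda>z. dilation (r n) f z - f z) holomorphic_on ball 0 1" for n
    using rn[of n] by (intro holomorphic_intros holomorphic_on_dilation f) auto
  have q_int: "(q n) integrable_on {-pi..pi}" for n
    using integrand_integrable[OF hol _ _ p, of \<rho> n] \<rho> unfolding q_eq z_def
    by (intro integrable_on_divide) auto
  have q_bd: "integral {-pi..pi} (q n) \<le> 2 * pi * C powr p" for n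
  proof -
    have "integral {-pi..pi} (\<lambda>\<theta>. norm (dilation (r n) f (z \<theta>) - f (z \<theta>)) powr p)
        \<le> 2 * pi * (C * (1 - r n)) powr p"
      using le[OF rn] rn[of n] C integral_mean_le_iff[OF p, of "C * (1 - r n)" \<rho> "\<lambda>z. dilation (r n) f z - f z"]
      by (simp add: z_def)
    then show ?thesis unfolding q_eq using rn[of n] C powr_mult[of C "1 - r n" p] by (simp add: field_simps)
  qed
  have "(\<lambda>n. integral {-pi..pi} (q n)) \<longlonglongrightarrow> integral {-pi..pi} (\<lambda>\<theta>. norm (deriv f (z \<theta>) * z \<theta>) powr p)"
    by (rule dominated_convergence(2)[OF q_int, where h = "\<lambda>_. B powr p"])
      (use q_le q_lim in \<open>auto simp: q_def\<close>)
  then have "integral {-pi..pi} (\<lambda>\<theta>. norm (deriv f (z \<theta>) * z \<theta>) powr p) \<le> 2 * pi * C powr p"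
    by (rule LIMSEQ_le_const2) (use q_bd in auto)
  then have "integral {-pi..pi} (\<lambda>\<theta>. norm (deriv f (z \<theta>)) powr p) \<le> 2 * pi * (C / \<rho>) powr p"
    using \<rho> C by (simp add: norm_mult nz powr_mult powr_divide field_simps)
  then show ?thesis using \<rho> C by (subst integral_mean_le_iff[OF p]) (auto simp: z_def)
qed

text \<open>
  The case \<open>\<alpha> < 1\<close>: \<open>2 * \<rho> - 1\<close> lies twice as far from \<open>1\<close> as \<open>\<rho>\<close>, so a bound
  \<open>K (1 - \<rho>) powr (\<alpha> - 1)\<close> at \<open>2 * \<rho> - 1\<close> comes with the factor \<open>c = 2 powr (\<alpha> - 1) < 1\<close> at \<open>\<rho>\<close>. It
  reproduces itself as soon as \<open>K c + D \<le> K\<close>. Finitely many doublings lead from any \<open>\<rho>\<close> to the range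
  \<open>\<rho> \<le> \<rho>1\<close>, where \<open>a\<close> is bounded.
\<close>

lemma doubling_recursion_bound:
  fixes a :: "real \<Rightarrow> real"
  assumes \<alpha>: "\<alpha> < 1" and \<rho>1: "1 / 2 \<le> \<rho>1" "\<rho>1 < 1"
    and base: "\<And>\<rho>. 0 \<le> \<rho> \<Longrightarrow> \<rho> \<le> \<rho>1 \<Longrightarrow> a \<rho> \<le> B" and B: "0 < B"
    and step: "\<And>\<rho>. \<rho>1 < \<rho> \<Longrightarrow> \<rho> < 1 \<Longrightarrow> a \<rho> \<le> a (2 * \<rho> - 1) + D * (1 - \<rho>) powr (\<alpha> - 1)"
  shows "\<exists>K>0. \<forall>\<rho>. 0 \<le> \<rho> \<and> \<rho> < 1 \<longrightarrow> a \<rho> \<le> K * (1 - \<rho>) powr (\<alpha> - 1)"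
proof -
  define c where "c = (2::real) powr (\<alpha> - 1)"
  have c: "c < 1" using \<alpha> powr_less_mono[of "\<alpha> - 1" 0 2] by (simp add: c_def)
  define K where "K = max B (D / (1 - c))"
  have KB: "B \<le> K" and "D / (1 - c) \<le> K" by (auto simp: K_def)
  then have KD: "K * c + D \<le> K" using c by (simp add: field_simps)
  have K: "0 < K" using B KB by simp
  have small: "a \<rho> \<le> K * (1 - \<rho>) powr (\<alpha> - 1)" if "0 \<le> \<rho>" "\<rho> \<le> \<rho>1" for \<rho>
  proof -
    have "1 \<le> (1 - \<rho>) powr (\<alpha> - 1)"
      using that \<rho>1 \<alpha> powr_mono2'[of "\<alpha> - 1" "1 - \<rho>" 1] by simp
    then have "K * 1 \<le> K * (1 - \<rho>) powr (\<alpha> - 1)" using K by (intro mult_left_mono) auto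
    then show ?thesis using base[OF that] KB by linarith
  qed
  have ind: "a \<rho> \<le> K * (1 - \<rho>) powr (\<alpha> - 1)"
    if "0 \<le> \<rho>" "\<rho> < 1" "1 - \<rho>1 \<le> 2 ^ n * (1 - \<rho>)" for n \<rho>
    using that
  proof (induction n arbitrary: \<rho>)
    case 0
    then show ?case by (intro small) auto
  next
    case (Suc n)
    show ?case
    proof (cases "\<rho> \<le> \<rho>1")
      case True
      then show ?thesis using Suc.prems by (intro small)
    next
      case False
      then have "a (2 * \<rho> - 1) \<le> K * (1 - (2 * \<rho> - 1)) powr (\<alpha> - 1)"
        using Suc.prems \<rho>1 by (intro Suc.IH) (auto simp: algebra_simps)
      also have "1 - (2 * \<rho> - 1) = 2 * (1 - \<rho>)" by simp
      also have "K * (2 * (1 - \<rho>)) powr (\<alpha> - 1) = K * c * (1 - \<rho>) powr (\<alpha> - 1)"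
        using powr_mult[of 2 "1 - \<rho>" "\<alpha> - 1"] by (simp add: c_def)
      finally have "a \<rho> \<le> (K * c + D) * (1 - \<rho>) powr (\<alpha> - 1)"
        using step[of \<rho>] False Suc.prems by (simp add: algebra_simps)
      also have "\<dots> \<le> K * (1 - \<rho>) powr (\<alpha> - 1)" using KD by (intro mult_right_mono) auto
      finally show ?thesis .
    qed
  qed
  have "a \<rho> \<le> K * (1 - \<rho>) powr (\<alpha> - 1)" if \<rho>: "0 \<le> \<rho>" "\<rho> < 1" for \<rho>
  proof -
    obtain n where "(1 - \<rho>1) / (1 - \<rho>) < 2 ^ n" using real_arch_pow[of 2] by auto
    then show ?thesis using \<rho> by (intro ind[of \<rho> n]) (auto simp: field_simps)
  qed
  with K show ?thesis by blast
qed

text \<open>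
  The step of the recursion: \<open>f' z = r f' (r z) - h' z\<close> with \<open>h = f\<^sub>r - f\<close>, and \<open>h'\<close> is estimated by
  Cauchy's formula on circles that reach halfway to the unit circle.
\<close>

lemma integral_mean_deriv_le_dilated:
  assumes p: "1 \<le> p" and f: "f holomorphic_on ball 0 1"
    and r: "0 \<le> r" "r < 1" and \<rho>: "0 \<le> \<rho>" "\<rho> < 1" and N: "0 \<le> N"
    and le: "\<And>s. 0 \<le> s \<Longrightarrow> s < 1 \<Longrightarrow> integral_mean p s (\<lambda>z. dilation r f z - f z) \<le> N"
  shows "integral_mean p \<rho> (deriv f) \<le> integral_mean p (r * \<rho>) (deriv f) + 2 * N / (1 - \<rho>)"
proof -
  define h where "h = (\<lambda>z. dilation r f z - f z)"
  define u where "u = (\<lambda>z. of_real r * dilation r (deriv f) z)"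
  have h: "h holomorphic_on ball 0 1"
    unfolding h_def using r by (intro holomorphic_intros holomorphic_on_dilation f) auto
  have f': "deriv f holomorphic_on ball 0 1" and h': "deriv h holomorphic_on ball 0 1"
    by (intro holomorphic_deriv f h, simp)+
  have u: "u holomorphic_on ball 0 1"
    unfolding u_def using r by (intro holomorphic_intros holomorphic_on_dilation f') auto
  have dh: "deriv f z = u z + - deriv h z" if z: "z \<in> ball 0 1" for z
  proof -
    have rz: "of_real r * z \<in> ball 0 1"
      using r z mult_left_le_one_le[of "norm z" r] by (simp add: norm_mult)
    have "(f has_field_derivative deriv f (of_real r * z)) (at (of_real r * z))"
      using rz by (intro holomorphic_derivI[OF f]) auto
    then have "((\<lambda>z. f (of_real r * z)) has_field_derivative deriv f (of_real r * z) * of_real r) (at z)"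
      by (rule DERIV_chain2) (auto intro!: derivative_eq_intros)
    then have "(h has_field_derivative deriv f (of_real r * z) * of_real r - deriv f z) (at z)"
      unfolding h_def dilation_def
      using z by (intro DERIV_diff holomorphic_derivI[OF f]) auto
    then show ?thesis by (simp add: DERIV_imp_deriv u_def dilation_def)
  qed
  have "integral_mean p \<rho> (deriv f) = integral_mean p \<rho> (\<lambda>z. u z + - deriv h z)"
    unfolding integral_mean_def using \<rho> by (simp add: dh norm_mult)
  also have "\<dots> \<le> integral_mean p \<rho> u + integral_mean p \<rho> (\<lambda>z. - deriv h z)"
    by (intro integral_mean_triangle p \<rho> u holomorphic_intros h')
  also have "integral_mean p \<rho> (\<lambda>z. - deriv h z) = integral_mean p \<rho> (deriv h)"
    by (simp add: integral_mean_def)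
  also have "integral_mean p \<rho> (deriv h) \<le> N / ((1 - \<rho>) / 2)"
    by (rule integral_mean_deriv_le_Cauchy[OF p h]) (use \<rho> N le in \<open>auto simp: h_def field_simps\<close>)
  also have "N / ((1 - \<rho>) / 2) = 2 * N / (1 - \<rho>)" by simp
  also have "integral_mean p \<rho> u \<le> integral_mean p \<rho> (dilation r (deriv f))"
  proof -
    let ?J = "\<lambda>g. integral {-pi..pi} (\<lambda>\<theta>. norm (g (of_real \<rho> * exp (\<i> * of_real \<theta>))) powr p)"
    have "?J u \<le> ?J (dilation r (deriv f))"
    proof (intro integral_le integrand_integrable[OF u] integrand_integrable[OF holomorphic_on_dilation[OF f']])
      fix \<theta> :: real
      show "norm (u (of_real \<rho> * exp (\<i> * of_real \<theta>))) powr p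
          \<le> norm (dilation r (deriv f) (of_real \<rho> * exp (\<i> * of_real \<theta>))) powr p"
        using r p by (intro powr_mono2) (auto simp: u_def norm_mult mult_left_le_one_le)
    qed (use p r \<rho> in auto)
    then show ?thesis
      by (subst integral_mean_le_iff[OF p]) (auto simp: integral_mean_powr[OF p] integral_mean_nonneg)
  qed
  also have "integral_mean p \<rho> (dilation r (deriv f)) = integral_mean p (r * \<rho>) (deriv f)"
    by (simp add: integral_mean_def dilation_def mult.assoc)
  finally show ?thesis by simp
qed

lemma integral_mean_deriv_bigo:
  assumes p: "1 \<le> p" and \<alpha>: "0 < \<alpha>" "\<alpha> \<le> 1" and f: "f \<in> hardy_space p"
    and O: "(\<lambda>r. hardy_norm p (\<lambda>z. dilation r f z - f z)) \<in> O[at_left 1](\<lambda>r. (1 - r) powr \<alpha>)"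
  shows "(\<lambda>r. integral_mean p r (deriv f)) \<in> O[at_left 1](\<lambda>r. (1 - r) powr (\<alpha> - 1))"
proof -
  have hf: "f holomorphic_on ball 0 1" using f by (simp add: hardy_space_def)
  from O obtain c where c: "c > 0" and
    "eventually (\<lambda>r. norm (hardy_norm p (\<lambda>z. dilation r f z - f z)) \<le> c * norm ((1 - r) powr \<alpha>)) (at_left 1)"
    by (elim landau_o.bigE)
  then obtain b where b: "b < 1" "\<And>r. b < r \<Longrightarrow> r < 1 \<Longrightarrow>
      norm (hardy_norm p (\<lambda>z. dilation r f z - f z)) \<le> c * norm ((1 - r) powr \<alpha>)"
    by (auto simp: eventually_at_left[of 0 "1::real"])
  have le: "integral_mean p s (\<lambda>z. dilation r f z - f z) \<le> c * (1 - r) powr \<alpha>"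
    if "b < r" "0 \<le> r" "r < 1" "0 \<le> s" "s < 1" for r s
    using integral_mean_le_hardy_norm[OF dilation_diff_in_hardy_space[OF p f], of r s] b(2)[of r] that
    by simp
  have "\<exists>K>0. \<forall>\<rho>. 1 / 2 \<le> \<rho> \<and> \<rho> < 1 \<longrightarrow> integral_mean p \<rho> (deriv f) \<le> K * (1 - \<rho>) powr (\<alpha> - 1)"
  proof (cases "\<alpha> = 1")
    case True
    have "integral_mean p \<rho> (deriv f) \<le> 2 * c * (1 - \<rho>) powr (\<alpha> - 1)" if \<rho>: "1 / 2 \<le> \<rho>" "\<rho> < 1" for \<rho>
    proof -
      have "integral_mean p \<rho> (deriv f) \<le> c / \<rho>"
        by (rule integral_mean_deriv_le_difference_quotient[OF p hf _ b(1)])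
          (use le \<rho> c True in \<open>auto\<close>)
      also have "\<dots> \<le> 2 * c" using \<rho> c by (simp add: field_simps)
      finally show ?thesis using True \<rho> by simp
    qed
    with c show ?thesis by (intro exI[of _ "2 * c"]) auto
  next
    case False
    (* For \<rho> > \<rho>1 the dilation factor 2 - 1 / \<rho> used in the recursion exceeds b'. *)
    define b' where "b' = max b 0"
    define \<rho>1 where "\<rho>1 = 1 / (2 - b')"
    have b': "0 \<le> b'" "b' < 1" using b(1) by (auto simp: b'_def)
    have \<rho>1: "1 / 2 \<le> \<rho>1" "\<rho>1 < 1" using b' by (auto simp: \<rho>1_def field_simps)
    have "deriv f holomorphic_on ball 0 1" by (intro holomorphic_deriv hf) auto
    from integral_mean_locally_bounded[OF p this \<rho>1(2)] obtain B where
      B: "0 < B" "\<And>r. 0 \<le> r \<Longrightarrow> r \<le> \<rho>1 \<Longrightarrow> integral_mean p r (deriv f) \<le> B" by blast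
    have step: "integral_mean p \<rho> (deriv f) \<le>
        integral_mean p (2 * \<rho> - 1) (deriv f) + 4 * c * (1 - \<rho>) powr (\<alpha> - 1)"
      if \<rho>: "\<rho>1 < \<rho>" "\<rho> < 1" for \<rho>
    proof -
      define r where "r = 2 - 1 / \<rho>"
      have \<rho>0: "1 / 2 < \<rho>" using \<rho> \<rho>1 by simp
      have "1 / \<rho> < 1 / \<rho>1" using \<rho> \<rho>1 by (intro divide_strict_left_mono) auto
      then have r1: "b' < r" using b' by (simp add: r_def \<rho>1_def)
      have r2: "r < 1" using \<rho> \<rho>0 by (simp add: r_def field_simps)
      have r\<rho>: "r * \<rho> = 2 * \<rho> - 1" using \<rho>0 by (simp add: r_def field_simps)
      have "1 - r = (1 - \<rho>) / \<rho>" using \<rho>0 by (simp add: r_def field_simps)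
      also have "\<dots> \<le> 2 * (1 - \<rho>)" using \<rho> \<rho>0 divide_left_mono[of "1 / 2" \<rho> "1 - \<rho>"] by simp
      finally have "(1 - r) powr \<alpha> \<le> (2 * (1 - \<rho>)) powr \<alpha>"
        using r2 \<alpha> by (intro powr_mono2) auto
      also have "\<dots> = 2 powr \<alpha> * (1 - \<rho>) powr \<alpha>" by (rule powr_mult)
      also have "\<dots> \<le> 2 * (1 - \<rho>) powr \<alpha>"
        using \<alpha> powr_mono[of \<alpha> 1 2] by (intro mult_right_mono) auto
      finally have "c * (1 - r) powr \<alpha> \<le> c * (2 * (1 - \<rho>) powr \<alpha>)" using c by simp
      then have N: "integral_mean p s (\<lambda>z. dilation r f z - f z) \<le> 2 * c * (1 - \<rho>) powr \<alpha>"
        if "0 \<le> s" "s < 1" for s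
        using le[of r s] that r1 r2 b' by (simp add: b'_def)
      have "integral_mean p \<rho> (deriv f) \<le>
          integral_mean p (r * \<rho>) (deriv f) + 2 * (2 * c * (1 - \<rho>) powr \<alpha>) / (1 - \<rho>)"
        by (rule integral_mean_deriv_le_dilated[OF p hf _ r2 _ \<rho>(2) _ N]) (use b' r1 \<rho>0 c in auto)
      also have "2 * (2 * c * (1 - \<rho>) powr \<alpha>) / (1 - \<rho>) = 4 * c * (1 - \<rho>) powr (\<alpha> - 1)"
        using \<rho> by (simp add: powr_diff)
      finally show ?thesis unfolding r\<rho> .
    qed
    have "\<exists>K>0. \<forall>\<rho>. 0 \<le> \<rho> \<and> \<rho> < 1 \<longrightarrow> integral_mean p \<rho> (deriv f) \<le> K * (1 - \<rho>) powr (\<alpha> - 1)"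
      by (rule doubling_recursion_bound[OF _ \<rho>1 B(2) B(1) step]) (use \<alpha> False in auto)
    then show ?thesis by force
  qed
  then obtain K where K: "K > 0" "\<And>\<rho>. 1 / 2 \<le> \<rho> \<Longrightarrow> \<rho> < 1 \<Longrightarrow>
      integral_mean p \<rho> (deriv f) \<le> K * (1 - \<rho>) powr (\<alpha> - 1)" by blast
  have "norm (integral_mean p \<rho> (deriv f)) \<le> K * norm ((1 - \<rho>) powr (\<alpha> - 1))"
    if "1 / 2 < \<rho>" "\<rho> < 1" for \<rho>
    using K(2)[of \<rho>] that by (simp add: integral_mean_nonneg)
  then show ?thesis
    by (intro landau_o.bigI[OF K(1)]) (auto simp: eventually_at_left[of 0 "1::real"] intro!: exI[of _ "1 / 2"])
qed

theorem theoremC: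
  fixes p \<alpha> :: real and f :: "complex \<Rightarrow> complex"
  assumes "1 \<le> p" and "0 < \<alpha>" and "\<alpha> \<le> 1" and "f \<in> hardy_space p"
  shows "(\<lambda>r. integral_mean p r (deriv f)) \<in> O[at_left 1](\<lambda>r. (1 - r) powr (\<alpha> - 1)) \<longleftrightarrow>
         (\<lambda>r. hardy_norm p (\<lambda>z. dilation r f z - f z)) \<in> O[at_left 1](\<lambda>r. (1 - r) powr \<alpha>)"
  using hardy_norm_dilation_diff_bigo[OF assms] integral_mean_deriv_bigo[OF assms] by blast

end
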